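(* For all $t\in(0,1)$, we have $$\lim_{N\to\infty}N\sum_{k=N+1}^\infty\frac{\cos(2k\pi t)}{k^2\pi^2}=0.$$
   Context: The limit is taken over positive integers $N$. *)

theory Defs
  imports "HOL-Analysis.Analysis"
begin

end

theory Submission
  imports Defs
begin

text \<open>
  Since \<open>2 sin(\<pi>t) cos(2k\<pi>t) = sin((2k+1)\<pi>t) - sin((2k-1)\<pi>t)\<close> and \<open>sin(\<pi>t) \<noteq> 0\<close>, the
  cosines are increments of a bounded sequence. Summation by parts against the decreasing weights
  \<open>1/(k\<pi>)\<^sup>2\<close> therefore bounds the tail by a constant times its first weight, which is
  \<open>O(1/N\<^sup>2)\<close>.
\<close>

lemma sum_by_parts_real:
  fixes a b :: "nat \<Rightarrow> real"
  shows "(\<Sum>j<m. a j * (b (Suc j) - b j))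
       = a m * b m - a 0 * b 0 + (\<Sum>j<m. (a j - a (Suc j)) * b (Suc j))"
  by (induction m) (simp_all add: algebra_simps)

text \<open>After summation by parts the differences \<open>a j - a (Suc j)\<close> are nonnegative
  and telescope, giving \<open>(a 0 - a m) * C\<close>. The boundary terms cost at most
  \<open>(a m + a 0) * C\<close>. The \<open>a m\<close> parts cancel, so the bound is uniform in
  \<open>m\<close>.\<close>

lemma abs_sum_decseq_mult_diff_le:
  fixes a b :: "nat \<Rightarrow> real"
  assumes dec: "decseq a" and nonneg: "\<And>j. 0 \<le> a j" and bound: "\<And>j. \<bar>b j\<bar> \<le> C"
  shows "\<bar>\<Sum>j<m. a j * (b (Suc j) - b j)\<bar> \<le> 2 * C * a 0"
proof -
  have "\<bar>\<Sum>j<m. (a j - a (Suc j)) * b (Suc j)\<bar> \<le> (\<Sum>j<m. (a j - a (Suc j)) * C)"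
    using decseq_SucD[OF dec] bound
    by (intro order.trans[OF sum_abs] sum_mono) (simp add: abs_mult mult_left_mono)
  also have "\<dots> = (a 0 - a m) * C"
    by (simp flip: sum_distrib_right add: sum_lessThan_telescope')
  finally have "\<bar>\<Sum>j<m. (a j - a (Suc j)) * b (Suc j)\<bar> \<le> (a 0 - a m) * C" .
  moreover have "\<bar>a i * b i\<bar> \<le> a i * C" for i
    using nonneg bound by (simp add: abs_mult mult_left_mono)
  from this[of 0] this[of m] have "\<bar>a m * b m - a 0 * b 0\<bar> \<le> a m * C + a 0 * C"
    by linarith
  ultimately show ?thesis
    unfolding sum_by_parts_real by (simp add: algebra_simps)
qed

lemma cos_eq_diff_sin:
  fixes t :: real
  assumes "sin (pi * t) \<noteq> 0"
  shows "cos (2 * x * pi * t)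
       = sin ((2 * x + 1) * pi * t) / (2 * sin (pi * t)) - sin ((2 * x - 1) * pi * t) / (2 * sin (pi * t))"
proof -
  have "sin ((2 * x + 1) * pi * t) = sin (2 * x * pi * t + pi * t)"
       "sin ((2 * x - 1) * pi * t) = sin (2 * x * pi * t - pi * t)"
    by (simp_all add: algebra_simps)
  then have "sin ((2 * x + 1) * pi * t) - sin ((2 * x - 1) * pi * t)
      = 2 * sin (pi * t) * cos (2 * x * pi * t)"
    by (simp only: sin_add sin_diff) simp
  with assms show ?thesis
    by (simp flip: diff_divide_distrib)
qed

lemma summable_cos_over_square:
  "summable (\<lambda>j::nat. cos (2 * real (n + j) * pi * t) / ((real (n + j))\<^sup>2 * pi\<^sup>2))"
proof -
  have "summable (\<lambda>k. inverse (real k ^ 2) * inverse (pi\<^sup>2))"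
    by (intro summable_mult2 inverse_power_summable) simp
  then have "summable (\<lambda>k. 1 / ((real k)\<^sup>2 * pi\<^sup>2))"
    by (simp add: inverse_eq_divide)
  \<comment> \<open>The comparison may start at \<open>k = 0\<close>: division by zero makes both
    terms there equal to 0.\<close>
  then have "summable (\<lambda>k. cos (2 * real k * pi * t) / ((real k)\<^sup>2 * pi\<^sup>2))"
    by (rule summable_comparison_test'[where N = 0])
       (simp add: divide_right_mono)
  from summable_ignore_initial_segment[OF this, of n] show ?thesis
    by (simp only: add.commute[of n])
qed

text \<open>The constant is \<open>2 * C * a 0\<close>, where \<open>C\<close> is the bound
  \<open>1 / (2 * \<bar>sin (pi * t)\<bar>)\<close> on the sine quotients and \<open>a 0\<close> is
  the first weight of the tail.\<close>

lemma abs_cos_tail_le: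
  fixes t :: real
  assumes "sin (pi * t) \<noteq> 0" and "n > 0"
  shows "\<bar>\<Sum>j. cos (2 * real (n + j) * pi * t) / ((real (n + j))\<^sup>2 * pi\<^sup>2)\<bar>
       \<le> 1 / \<bar>sin (pi * t)\<bar> / ((real n)\<^sup>2 * pi\<^sup>2)"
proof -
  define a where "a j = 1 / ((real (n + j))\<^sup>2 * pi\<^sup>2)" for j
  \<comment> \<open>The argument sits half a step below \<open>n + j\<close>, so that the increment
    from \<open>j\<close> to \<open>Suc j\<close> is centred at \<open>n + j\<close>.\<close>
  define b where "b j = sin ((2 * real (n + j) - 1) * pi * t) / (2 * sin (pi * t))" for j
  have "b (Suc j) - b j = cos (2 * real (n + j) * pi * t)" for j
    unfolding cos_eq_diff_sin[OF assms(1)] b_def by (simp add: algebra_simps)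
  then have summand: "cos (2 * real (n + j) * pi * t) / ((real (n + j))\<^sup>2 * pi\<^sup>2)
      = a j * (b (Suc j) - b j)" for j
    by (simp add: a_def)
  \<comment> \<open>Positivity of \<open>n\<close> matters: for \<open>n = 0\<close> the first
    weight would be \<open>1 / 0 = 0\<close>, below the next one.\<close>
  have "decseq a"
    using assms(2) unfolding a_def
    by (intro decseq_SucI divide_left_mono mult_right_mono power_mono mult_pos_pos) auto
  moreover have "0 \<le> a j" for j
    by (simp add: a_def)
  moreover have "\<bar>b j\<bar> \<le> 1 / (2 * \<bar>sin (pi * t)\<bar>)" for j
    unfolding b_def abs_divide abs_mult using abs_sin_le_one by (intro frac_le) (use assms(1) in auto)
  ultimately have "\<bar>\<Sum>j<m. a j * (b (Suc j) - b j)\<bar> \<le> 2 * (1 / (2 * \<bar>sin (pi * t)\<bar>)) * a 0" for m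
    by (rule abs_sum_decseq_mult_diff_le)
  \<comment> \<open>Summability lets the bound, uniform in \<open>m\<close>, pass from partial sums
    to the infinite sum.\<close>
  moreover have "(\<lambda>m. \<Sum>j<m. a j * (b (Suc j) - b j)) \<longlonglongrightarrow> (\<Sum>j. a j * (b (Suc j) - b j))"
    using summable_LIMSEQ[OF summable_cos_over_square[of n t]] unfolding summand .
  ultimately have "\<bar>\<Sum>j. a j * (b (Suc j) - b j)\<bar> \<le> 2 * (1 / (2 * \<bar>sin (pi * t)\<bar>)) * a 0"
    by (intro LIMSEQ_le_const2[OF tendsto_rabs]) auto
  then show ?thesis
    unfolding summand by (simp add: a_def)
qed

theorem corollary1p3:
  fixes t :: real
  assumes "t \<in> {0<..<1}"
  shows "(\<lambda>N::nat. real N *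
           (\<Sum>j::nat. cos (2 * real (N + 1 + j) * pi * t) / ((real (N + 1 + j))\<^sup>2 * pi\<^sup>2)))
         \<longlonglongrightarrow> 0"
proof -
  define c where "c = 1 / \<bar>sin (pi * t)\<bar> / pi\<^sup>2"
  have "sin (pi * t) > 0"
    using assms by (intro sin_gt_zero) auto
  then have "\<bar>\<Sum>j. cos (2 * real (N + 1 + j) * pi * t) / ((real (N + 1 + j))\<^sup>2 * pi\<^sup>2)\<bar>
      \<le> c / (real (N + 1))\<^sup>2" for N
    using abs_cos_tail_le[of t "N + 1"] unfolding c_def by (simp add: mult_ac)
  then have "norm (real N * (\<Sum>j. cos (2 * real (N + 1 + j) * pi * t) / ((real (N + 1 + j))\<^sup>2 * pi\<^sup>2)))
      \<le> real N * (c / (real (N + 1))\<^sup>2)" for N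
    unfolding real_norm_def abs_mult abs_of_nat by (rule mult_left_mono) simp
  \<comment> \<open>Enlarging the factor \<open>N\<close> to \<open>N + 1\<close> cancels one power
    of the denominator and leaves a shifted null sequence \<open>c / n\<close>.\<close>
  moreover have "real N * (c / (real (N + 1))\<^sup>2) \<le> c / real (Suc N)" for N
  proof -
    have "real N * (c / (real (N + 1))\<^sup>2) \<le> real (N + 1) * (c / (real (N + 1))\<^sup>2)"
      by (intro mult_right_mono) (simp_all add: c_def)
    then show ?thesis
      by (simp add: power2_eq_square)
  qed
  ultimately have "norm (real N *
      (\<Sum>j. cos (2 * real (N + 1 + j) * pi * t) / ((real (N + 1 + j))\<^sup>2 * pi\<^sup>2))) \<le> c / real (Suc N)" for N
    by (rule order.trans)
  then show ?thesis
    by (intro Lim_null_comparison[OF always_eventually LIMSEQ_Suc[OF lim_const_over_n]] allI)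
qed

end
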